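(* Let $p$ be a prime, $q=p^e>4$, and let $\ell$ be a positive integer with $2\ell\mid e$. Let $\boldsymbol a=(a_1,\ldots,a_n)$ be a vector of pairwise distinct elements of $\mathbb F_q$ and put $u_i=\prod_{1\le j\le n,\,j\ne i}(a_i-a_j)^{-1}$. Let $\delta\in\mathbb Z_{>0}$, $\lambda\in\mathbb F_q^{*}$ and $s\ge1$, and assume that $\lambda a_i^{\delta-1}u_i\in\mathbb F_{p^\ell}^{*}$ for $1\le i\le n$. Then, for every integer $k$ with $s<k\le\left\lfloor\frac{n+p^\ell-\delta+1}{p^\ell+1}\right\rfloor$ and every integer $h$ with $0\le h\le k-s$, there exists an $[n+s,k]_q$ generalized Roth-Lempel code $C$ such that $\dim(\operatorname{Hull}_{\ell}(C))=h$. In the boundary case $\delta-1+p^\ell(k-1)=n-k$, such a $C$ can be obtained by choosing $\eta\in(\mathbb F_q^{*})^{p^\ell+1}$ with $\eta\ne\lambda$ and taking the extension matrix $A_s\in\operatorname{GL}_s(\mathbb F_q)$ to satisfy $A_s^{(p^\ell)}A_s^{T}=-\eta I_s$.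
   Context: For $q=p^e$ and $0\le\ell\le e-1$, the $\ell$-Galois inner product on $\mathbb F_q^N$ is $\langle\boldsymbol x,\boldsymbol y\rangle_\ell=\sum_i x_iy_i^{p^\ell}$. For a linear code $C\subseteq\mathbb F_q^N$, $C^{\perp_\ell}=\{\boldsymbol x\in\mathbb F_q^N:\langle\boldsymbol c,\boldsymbol x\rangle_\ell=0\ \text{for all }\boldsymbol c\in C\}$ and $\operatorname{Hull}_\ell(C)=C\cap C^{\perp_\ell}$. Generalized Roth-Lempel (GRL) code: let $1\le s\le k\le n$, let $\boldsymbol a\in\mathbb F_q^n$ have pairwise distinct entries, let $\boldsymbol v\in(\mathbb F_q^* )^n$ and $A_s\in\operatorname{GL}_s(\mathbb F_q)$. Then $\operatorname{GRL}_k(\boldsymbol a,\boldsymbol v,A_s)$ is the $[n+s,k]_q$ linear code $$\{(v_1f(a_1),\ldots,v_nf(a_n),(f_{k-s},\ldots,f_{k-1})A_s): f(x)=\textstyle\sum_{j=0}^{k-1}f_jx^j\in\mathbb F_q[x]\}.$$ The matrix $A_s$ is called its extension matrix. An $[N,k]_q$ code is a $k$-dimensional subspace of $\mathbb F_q^N$. $A^{(p^\ell)}$ denotes the matrix obtained from $A$ by raising every entry to the power $p^\ell$; $(\mathbb F_q^{*})^{p^\ell+1}$ is the group of $(p^\ell+1)$-th powers in $\mathbb F_q^*$. Convention: $x^0=1$, including $0^0=1$. *)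

theory Defs
  imports "HOL-Library.Cardinality" "HOL-Algebra.Subrings" "Jordan_Normal_Form.VS_Connect"
begin

text \<open>Row vectors of length \<open>N\<close> over the finite field \<open>'a\<close> are elements of \<open>carrier_vec N\<close>, so
  all coordinates are indexed from 0.\<close>

definition code_dim :: "nat \<Rightarrow> 'a::field vec set \<Rightarrow> nat" where
  "code_dim N C = vectorspace.dim class_ring ((module_vec TYPE('a) N)\<lparr>carrier := C\<rparr>)"

definition linear_code :: "nat \<Rightarrow> nat \<Rightarrow> 'a::field vec set \<Rightarrow> bool" where
  "linear_code N k C \<longleftrightarrow>
     VectorSpace.subspace class_ring C (module_vec TYPE('a) N) \<and> code_dim N C = k"

definition galois_inner :: "nat \<Rightarrow> nat \<Rightarrow> 'a::field vec \<Rightarrow> 'a vec \<Rightarrow> 'a" where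
  "galois_inner p l x y = (\<Sum>i<dim_vec y. x $ i * (y $ i) ^ (p ^ l))"

definition galois_dual :: "nat \<Rightarrow> nat \<Rightarrow> nat \<Rightarrow> 'a::field vec set \<Rightarrow> 'a vec set" where
  "galois_dual p l N C = {x \<in> carrier_vec N. \<forall>c\<in>C. galois_inner p l c x = 0}"

definition galois_hull :: "nat \<Rightarrow> nat \<Rightarrow> nat \<Rightarrow> 'a::field vec set \<Rightarrow> 'a vec set" where
  "galois_hull p l N C = C \<inter> galois_dual p l N C"

definition GL :: "nat \<Rightarrow> 'a::field mat set" where
  "GL s = {A \<in> carrier_mat s s. invertible_mat A}"

text \<open>With \<open>s = dim_row A\<close>, the last \<open>s\<close> coordinates are the row vector
  \<open>(f_{k-s}, ..., f_{k-1}) A\<close>; the library only multiplies column vectors from the left,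
  hence the transpose. For \<open>k \<ge> 1\<close> the polynomials \<open>f_0 + ... + f_{k-1} x^{k-1}\<close> are exactly those
  with \<open>degree f < k\<close>.\<close>

definition grl_code :: "nat \<Rightarrow> 'a::field vec \<Rightarrow> 'a vec \<Rightarrow> 'a mat \<Rightarrow> 'a vec set" where
  "grl_code k a v A =
     {vec (dim_vec a) (\<lambda>i. v $ i * poly f (a $ i)) @\<^sub>v
      transpose_mat A *\<^sub>v vec (dim_row A) (\<lambda>j. coeff f (k - dim_row A + j)) | f. degree f < k}"

definition grl_params :: "nat \<Rightarrow> nat \<Rightarrow> nat \<Rightarrow> 'a::field vec \<Rightarrow> 'a vec \<Rightarrow> 'a mat \<Rightarrow> bool" where
  "grl_params n s k a v A \<longleftrightarrow>
     1 \<le> s \<and> s \<le> k \<and> k \<le> n \<and>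
     a \<in> carrier_vec n \<and> inj_on (\<lambda>i. a $ i) {..<n} \<and>
     v \<in> carrier_vec n \<and> (\<forall>i<n. v $ i \<noteq> 0) \<and>
     A \<in> GL s"

definition u_coeff :: "'a::field vec \<Rightarrow> nat \<Rightarrow> 'a" where
  "u_coeff a i = (\<Prod>j\<in>{..<dim_vec a} - {i}. inverse (a $ i - a $ j))"

definition unit_powers :: "nat \<Rightarrow> 'a::field set" where
  "unit_powers m = (\<lambda>y. y ^ m) ` (UNIV - {0})"

end

theory Submission
  imports Defs "HOL-Number_Theory.Residues"
begin

text \<open>Write \<open>Q = p ^ l\<close>. The inner product of the code words of \<open>f\<close> and \<open>g\<close> is
  \<open>\<Sum>i. v_i^(Q+1) f(a_i) g(a_i)^Q - \<eta> \<Sum>j. f_j g_j^Q\<close>, the second sum ranging over the top \<open>s\<close>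
  coefficients. If \<open>v_i^(Q+1) = \<lambda> a_i^(\<delta>-1) u_i\<close>, which is solvable because every nonzero element of
  the subfield of order \<open>Q\<close> is a \<open>(Q+1)\<close>-th power, then Lagrange interpolation collapses the
  first sum to \<open>\<lambda> f_{k-1} g_{k-1}^Q\<close> in the boundary case and to 0 otherwise. As \<open>\<eta> \<noteq> \<lambda>\<close>, the
  radical then consists of the polynomials of degree below \<open>k - s\<close>. Multiplying the first
  \<open>k - s - h\<close> entries of \<open>v\<close> by some \<open>y\<close> with \<open>y^(Q+1) \<noteq> 1\<close> adds a nondegenerate form in the
  evaluations at the corresponding \<open>a_i\<close>, which cuts the radical down to the multiples of
  \<open>\<Prod>i. (x - a_i)\<close>, a space of dimension \<open>h\<close>.\<close>

section \<open>Lagrange interpolation and top coefficients\<close>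

text \<open>By its degree, \<open>P\<close> equals its own interpolant \<open>L\<close> through
  \<open>A\<close>. Each basis product \<open>N x\<close> is monic of degree
  \<open>card A - 1\<close>, so comparing coefficients there leaves the bare sum of the
  \<open>c x\<close>.\<close>

lemma sum_lagrange_weights:
  fixes P :: "'a::field poly"
  assumes "finite A" and "degree P < card A"
  shows "(\<Sum>x\<in>A. poly P x * (\<Prod>y\<in>A - {x}. inverse (x - y))) = coeff P (card A - 1)"
proof -
  define N where "N x = (\<Prod>y\<in>A - {x}. [:- y, 1:])" for x
  define c where "c x = poly P x * (\<Prod>y\<in>A - {x}. inverse (x - y))" for x
  define L where "L = (\<Sum>x\<in>A. Polynomial.smult (c x) (N x))"
  have deg_N: "degree (N x) = card A - 1" if "x \<in> A" for x
    using that assms(1) by (simp add: N_def degree_prod_eq_sum_degree)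
  have lead_N: "lead_coeff (N x) = 1" for x
    unfolding N_def lead_coeff_prod by simp
  have "degree L \<le> card A - 1"
    unfolding L_def using assms(1) deg_N
    by (intro degree_sum_le) (auto intro: order_trans[OF degree_smult_le])
  then have deg_L: "degree L < card A" using assms(2) by linarith
  have "poly P x = poly L x" if x: "x \<in> A" for x
  proof -
    have "poly (N z) x = 0" if "z \<in> A" "z \<noteq> x" for z
      using x that assms(1) by (auto simp: N_def poly_prod)
    then have "poly L x = (\<Sum>z\<in>{x}. c z * poly (N z) x)"
      unfolding L_def poly_sum poly_smult using x assms(1)
      by (intro sum.mono_neutral_right) auto
    also have "\<dots> = poly P x * (\<Prod>y\<in>A - {x}. inverse (x - y) * (x - y))"
      by (simp add: c_def N_def poly_prod prod.distrib mult.assoc)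
    also have "(\<Prod>y\<in>A - {x}. inverse (x - y) * (x - y)) = 1" by (intro prod.neutral ballI left_inverse) auto
    finally show ?thesis by simp
  qed
  then have "P = L" using assms(2) deg_L by (intro poly_eqI_degree[of A]) auto
  then have "coeff P (card A - 1) = (\<Sum>x\<in>A. c x * coeff (N x) (card A - 1))"
    by (simp add: L_def coeff_sum)
  also have "\<dots> = (\<Sum>x\<in>A. c x)"
    using lead_N deg_N by (intro sum.cong) (auto simp del: lead_coeff_pCons, metis mult.right_neutral)
  finally show ?thesis by (simp add: c_def)
qed

lemma sum_u_coeff:
  fixes P :: "'a::field poly"
  assumes "inj_on (\<lambda>i. a $ i) {..<dim_vec a}" and "degree P < dim_vec a"
  shows "(\<Sum>i<dim_vec a. poly P (a $ i) * u_coeff a i) = coeff P (dim_vec a - 1)"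
proof -
  let ?I = "{..<dim_vec a}"
  let ?A = "(\<lambda>i. a $ i) ` ?I"
  have card: "card ?A = dim_vec a" using card_image[OF assms(1)] by simp
  have u: "u_coeff a i = (\<Prod>y\<in>?A - {a $ i}. inverse (a $ i - y))" if "i \<in> ?I" for i
  proof -
    have "?A - {a $ i} = (\<lambda>i. a $ i) ` (?I - {i})"
      using that inj_on_image_set_diff[OF assms(1), of ?I "{i}"] by auto
    moreover have "inj_on (\<lambda>i. a $ i) (?I - {i})" by (rule inj_on_subset[OF assms(1)]) auto
    ultimately show ?thesis by (simp add: u_coeff_def prod.reindex)
  qed
  have "(\<Sum>i<dim_vec a. poly P (a $ i) * u_coeff a i) =
      (\<Sum>x\<in>?A. poly P x * (\<Prod>y\<in>?A - {x}. inverse (x - y)))"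
    using u by (simp add: sum.reindex[OF assms(1)])
  also have "\<dots> = coeff P (dim_vec a - 1)"
    using sum_lagrange_weights[of ?A P] assms(2) card by simp
  finally show ?thesis .
qed

text \<open>In the convolution only index \<open>m\<close> survives: below it the factor from
  \<open>g\<close> is past its bound, above it the one from \<open>f\<close>. Bounds in place of
  exact degrees keep this usable when a top coefficient vanishes.\<close>

lemma coeff_mult_at_degree_bounds:
  fixes f g :: "'a::comm_semiring_1 poly"
  assumes "degree f \<le> m" and "degree g \<le> n"
  shows "coeff (f * g) (m + n) = coeff f m * coeff g n"
proof -
  have "coeff f i * coeff g (m + n - i) = 0" if "i \<in> {..m + n} - {m}" for i
    using that assms by (cases "i < m") (auto simp: coeff_eq_0)
  then have "(\<Sum>i\<le>m + n. coeff f i * coeff g (m + n - i)) = (\<Sum>i\<in>{m}. coeff f i * coeff g (m + n - i))"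
    by (intro sum.mono_neutral_right) auto
  then show ?thesis by (simp add: coeff_mult)
qed

lemma coeff_power_at_degree_bound:
  fixes f :: "'a::comm_semiring_1 poly"
  assumes "degree f \<le> m"
  shows "coeff (f ^ r) (m * r) = coeff f m ^ r"
proof (induction r)
  case (Suc r)
  have "degree (f ^ r) \<le> m * r"
    using degree_power_le[of f r] mult_le_mono1[OF assms, of r] by linarith
  then show ?case
    using coeff_mult_at_degree_bounds[OF assms] Suc by simp
qed simp

section \<open>Powers in the multiplicative group of a finite field\<close>

text \<open>Carries cyclicity of the unit group over from \<open>class_ring\<close> to ordinary
  powers; the last clause says that \<open>g\<close> has order \<open>CARD('a) - 1\<close>.\<close>

lemma finite_field_generator:
  obtains g :: "'a::{finite,field}" where "g \<noteq> 0"
    and "\<And>x. x \<noteq> 0 \<Longrightarrow> \<exists>i. x = g ^ i"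
    and "\<And>i. g ^ i = 1 \<longleftrightarrow> CARD('a) - 1 dvd i"
proof -
  let ?R = "class_ring :: 'a ring"
  let ?G = "mult_of ?R"
  interpret G: group ?G by (rule field.field_mult_group[OF class_field])
  have carrier: "carrier ?G = UNIV - {0}" by simp
  have pow: "x [^]\<^bsub>?G\<^esub> i = x ^ i" for x :: 'a and i :: nat
    by (simp add: nat_pow_mult_of class_ring_simps)
  have fin: "finite (carrier ?G)" by simp
  have fin_R: "finite (carrier ?R)" by simp
  have "\<exists>g\<in>carrier ?G. carrier ?G = {g [^]\<^bsub>?G\<^esub> i | i::nat. i \<in> UNIV}"
    using field.finite_field_mult_group_has_gen[OF class_field fin_R] by (simp add: nat_pow_mult_of)
  then obtain g where g: "g \<in> carrier ?G"
    and gen: "carrier ?G = {g [^]\<^bsub>?G\<^esub> i | i::nat. i \<in> UNIV}" by blast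
  have "G.ord g = card (carrier ?G)"
    using G.generate_pow_card[OF g] G.generate_pow_nat[OF g] G.ord_ge_1[OF fin g] gen by simp
  also have "\<dots> = CARD('a) - 1" unfolding carrier by (simp add: card_Diff_singleton)
  finally have ord: "G.ord g = CARD('a) - 1" .
  show thesis
  proof
    show "g \<noteq> 0" using g by simp
    show "\<exists>i. x = g ^ i" if "x \<noteq> 0" for x
      using that gen unfolding carrier pow by auto
    show "g ^ i = 1 \<longleftrightarrow> CARD('a) - 1 dvd i" for i
      using G.pow_eq_id[OF g, of i] unfolding ord pow by simp
  qed
qed

text \<open>Fermat's argument: multiplication by \<open>w\<close> permutes \<open>K - {0}\<close>,
  so the product of all its elements absorbs the factor \<open>w ^ card (K - {0})\<close>.\<close>

lemma subfield_elem_power_eq_one: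
  fixes K :: "'a::field set"
  assumes "subfield K class_ring" and "finite K" and "w \<in> K - {0}"
  shows "w ^ (card K - 1) = 1"
proof -
  interpret subfield K "class_ring :: 'a ring" by fact
  have closed: "x * y \<in> K" if "x \<in> K" "y \<in> K" for x y
    using that m_closed by simp
  have sub: "(*) w ` (K - {0}) \<subseteq> K - {0}" using assms(3) closed
    by (intro image_subsetI) (metis DiffD1 DiffD2 DiffI mult_eq_0_iff singleton_iff)
  have inj: "inj_on ((*) w) (K - {0})" using assms(3) by (auto intro: inj_onI)
  have "(*) w ` (K - {0}) = K - {0}"
    by (rule endo_inj_surj) (use assms(2) sub inj in auto)
  then have "(\<Prod>x\<in>K - {0}. x) = (\<Prod>x\<in>(*) w ` (K - {0}). x)" by simp
  also have "\<dots> = (\<Prod>x\<in>K - {0}. w * x)" using inj by (simp add: prod.reindex)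
  also have "\<dots> = w ^ card (K - {0}) * (\<Prod>x\<in>K - {0}. x)" by (simp add: prod.distrib)
  finally have "w ^ card (K - {0}) = 1" using assms(2) by simp
  moreover have "0 \<in> K" using subringE(2)[OF subring_axioms] by simp
  ultimately show ?thesis using assms(2) by (simp add: card_Diff_singleton)
qed

text \<open>Used to make \<open>- 1\<close>, and hence \<open>- \<eta>\<close>, a
  \<open>(Q + 1)\<close>-th power when the extension matrix is built.\<close>

lemma minus_one_in_subfield:
  fixes K :: "'a::field set"
  assumes "subfield K class_ring"
  shows "- 1 \<in> K - {0}"
proof -
  interpret subfield K "class_ring :: 'a ring" by fact
  have "1 \<in> K" using one_closed by simp
  then have "- 1 \<in> K"
    using subringE(5)[OF subring_axioms, of 1] by (simp add: class_ring_simps)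
  then show ?thesis by simp
qed

text \<open>With \<open>w = g ^ i\<close>, the relation \<open>w ^ (Q - 1) = 1\<close> makes
  \<open>(Q + 1) * (Q - 1)\<close> divide \<open>i * (Q - 1)\<close>, so \<open>Q + 1\<close>
  divides \<open>i\<close>. For a field of order \<open>Q ^ 2\<close> this is surjectivity of the
  norm onto \<open>K\<close>.\<close>

lemma subfield_subset_unit_powers:
  fixes K :: "'a::{finite,field} set"
  assumes "subfield K class_ring" and "card K = Q" and "Q > 1" and "Q ^ 2 - 1 dvd CARD('a) - 1"
  shows "K - {0} \<subseteq> unit_powers (Q + 1)"
proof
  fix w assume w: "w \<in> K - {0}"
  obtain g :: 'a where g: "g \<noteq> 0" "\<And>x. x \<noteq> 0 \<Longrightarrow> \<exists>i. x = g ^ i"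
    "\<And>i. g ^ i = 1 \<longleftrightarrow> CARD('a) - 1 dvd i"
    using finite_field_generator by blast
  obtain i where i: "w = g ^ i" using g(2) w by blast
  have "g ^ (i * (Q - 1)) = 1"
    using subfield_elem_power_eq_one[OF assms(1) _ w] assms(2) by (simp add: i power_mult)
  then have "Q ^ 2 - 1 dvd i * (Q - 1)" using g(3) assms(4) dvd_trans by blast
  moreover have "Q ^ 2 - 1 = (Q + 1) * (Q - 1)"
    by (simp add: power2_eq_square algebra_simps)
  ultimately obtain c where "i * (Q - 1) = (Q + 1) * (Q - 1) * c" by (metis dvdE)
  then have "i * (Q - 1) = (Q + 1) * c * (Q - 1)" by (simp only: mult_ac)
  then have "i = (Q + 1) * c" using assms(3) by (simp only: mult_cancel2) simp
  then have "w = (g ^ c) ^ (Q + 1)" using i by (simp only: power_mult[symmetric] mult.commute)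
  then show "w \<in> unit_powers (Q + 1)" using g(1) by (auto simp: unit_powers_def)
qed

text \<open>A generator serves as \<open>y\<close>, since its order exceeds
  \<open>m\<close>.\<close>

lemma exists_unit_power_neq_one:
  assumes "m + 1 < CARD('a::{finite,field})" and "m > 0"
  shows "\<exists>y::'a. y \<noteq> 0 \<and> y ^ m \<noteq> 1"
proof -
  obtain g :: 'a where g: "g \<noteq> 0" "\<And>i. g ^ i = 1 \<longleftrightarrow> CARD('a) - 1 dvd i"
    using finite_field_generator[where ?'a = 'a] by metis
  have "\<not> CARD('a) - 1 dvd m" using assms dvd_imp_le[of "CARD('a) - 1" m] by linarith
  then show ?thesis using g by blast
qed

lemma CHAR_eq_prime:
  assumes "prime p" and "CARD('a::{finite,field}) = p ^ e"
  shows "CHAR('a) = p"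
proof -
  have "prime CHAR('a)"
    by (rule prime_CHAR_semidom[OF finite_imp_CHAR_pos]) simp
  moreover have "CHAR('a) dvd p ^ e" using CHAR_dvd_CARD[where ?'a = 'a] assms(2) by simp
  ultimately show ?thesis
    using assms(1) by (metis prime_dvd_power primes_dvd_imp_eq)
qed

section \<open>Dimension of injective images of polynomial spaces\<close>

text \<open>Gives the dimension of both the code and its hull. Since the zero polynomial has degree
  0, the disjunct \<open>f = 0\<close> is what makes the case \<open>m = 0\<close> the zero space,
  as needed for a trivial hull.\<close>

lemma linear_code_image:
  fixes \<phi> :: "'a::field poly \<Rightarrow> 'a vec"
  assumes add: "\<And>f g. \<phi> (f + g) = \<phi> f + \<phi> g"
    and smult: "\<And>c f. \<phi> (Polynomial.smult c f) = c \<cdot>\<^sub>v \<phi> f"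
    and carrier: "\<And>f. \<phi> f \<in> carrier_vec N"
    and inj: "\<And>f. degree f < m \<Longrightarrow> \<phi> f = 0\<^sub>v N \<Longrightarrow> f = 0"
  shows "linear_code N m (\<phi> ` {f. f = 0 \<or> degree f < m})"
proof -
  let ?V = "module_vec TYPE('a) m" and ?W = "module_vec TYPE('a) N"
  let ?P = "{f :: 'a poly. f = 0 \<or> degree f < m}"
  let ?C = "\<phi> ` ?P"
  \<comment> \<open>Membership by vanishing coefficients treats \<open>m = 0\<close> uniformly and
    makes closure immediate.\<close>
  have P_coeff: "f \<in> ?P \<longleftrightarrow> (\<forall>i\<ge>m. coeff f i = 0)" for f
    using degree_lessI[of f m] by (auto intro: coeff_eq_0)
  have P_add: "f + g \<in> ?P" if "f \<in> ?P" "g \<in> ?P" for f g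
    using that unfolding P_coeff by simp
  have P_smult: "Polynomial.smult c f \<in> ?P" if "f \<in> ?P" for c f
    using that unfolding P_coeff by simp
  have "0 \<cdot>\<^sub>v \<phi> 0 = 0\<^sub>v N" using carrier[of 0] by (intro eq_vecI) auto
  then have zero: "\<phi> 0 = 0\<^sub>v N" using smult[of 0 0] by simp
  have sub: "VectorSpace.subspace class_ring ?C ?W"
    unfolding VectorSpace.subspace_def submodule_def
  proof (intro conjI allI impI)
    show "vectorspace class_ring ?W" by (rule vec_vs)
    show "Module.module class_ring ?W" by (rule vec_module)
    show "?C \<subseteq> carrier ?W" using carrier by (auto simp: module_vec_simps)
    show "v \<oplus>\<^bsub>?W\<^esub> w \<in> ?C" if "v \<in> ?C" "w \<in> ?C" for v w
      using that P_add add[symmetric] unfolding module_vec_simps by blast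
    show "\<zero>\<^bsub>?W\<^esub> \<in> ?C" unfolding module_vec_simps using zero by force
    show "c \<odot>\<^bsub>?W\<^esub> v \<in> ?C" if "v \<in> ?C" for c v
      using that P_smult smult[symmetric] unfolding module_vec_simps by blast
  qed
  \<comment> \<open>\<open>pol\<close> rebuilds a polynomial from its coefficient vector, so \<phi>
    after \<open>pol\<close> is an isomorphism from the coordinate space of dimension
    \<open>m\<close> onto \<open>?C\<close>.\<close>
  define pol where "pol x = (\<Sum>i<m. Polynomial.monom (x $ i) i)" for x :: "'a vec"
  have coeff_pol: "coeff (pol x) i = (if i < m then x $ i else 0)" for x i
    by (simp add: pol_def coeff_sum)
  have pol_P: "pol x \<in> ?P" for x unfolding P_coeff by (simp add: coeff_pol)
  have pol_add: "pol (x + y) = pol x + pol y" if "x \<in> carrier_vec m" "y \<in> carrier_vec m" for x y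
    using that by (intro poly_eqI) (simp add: coeff_pol)
  have pol_smult: "pol (c \<cdot>\<^sub>v x) = Polynomial.smult c (pol x)" if "x \<in> carrier_vec m" for c x
    using that by (intro poly_eqI) (simp add: coeff_pol)
  have pol_surj: "pol (vec m (coeff f)) = f" if "f \<in> ?P" for f
    using that unfolding P_coeff by (intro poly_eqI) (simp add: coeff_pol)
  let ?T = "\<lambda>x. \<phi> (pol x)"
  have surj: "?T ` carrier_vec m = ?C"
  proof
    show "?T ` carrier_vec m \<subseteq> ?C" using pol_P by blast
    show "?C \<subseteq> ?T ` carrier_vec m"
    proof
      fix y assume "y \<in> ?C"
      then obtain f where f: "f \<in> ?P" "y = \<phi> f" by blast
      have "vec m (coeff f) \<in> carrier_vec m" by simp
      then show "y \<in> ?T ` carrier_vec m" using pol_surj[OF f(1)] f(2) by (metis imageI)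
    qed
  qed
  have vsC: "vectorspace class_ring (?W\<lparr>carrier := ?C\<rparr>)"
    by (rule vectorspace.subspace_is_vs[OF vec_vs sub])
  interpret T: linear_map class_ring ?V "?W\<lparr>carrier := ?C\<rparr>" ?T
  proof (intro linear_map.intro mod_hom.intro mod_hom_axioms.intro)
    show "vectorspace class_ring ?V" by (rule vec_vs)
    show "vectorspace class_ring (?W\<lparr>carrier := ?C\<rparr>)" by (rule vsC)
    show "Module.module class_ring ?V" by (rule vec_module)
    show "Module.module class_ring (?W\<lparr>carrier := ?C\<rparr>)" using vsC by (simp add: vectorspace_def)
    show "?T \<in> LinearCombinations.module_hom class_ring ?V (?W\<lparr>carrier := ?C\<rparr>)"
      unfolding LinearCombinations.module_hom_def
      using pol_P pol_add pol_smult add smult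
      by (auto simp: module_vec_simps)
  qed
  have inj_T: "inj_on ?T (carrier ?V)"
  proof (rule inj_onI)
    fix x y assume "x \<in> carrier ?V" "y \<in> carrier ?V" and eq: "?T x = ?T y"
    then have x: "x \<in> carrier_vec m" and y: "y \<in> carrier_vec m" by (simp_all add: module_vec_simps)
    let ?d = "pol x + Polynomial.smult (- 1) (pol y)"
    have "?d \<in> ?P" by (intro P_add P_smult pol_P)
    moreover have "\<phi> ?d = \<phi> (pol y) + - 1 \<cdot>\<^sub>v \<phi> (pol y)" by (simp only: add smult eq)
    then have "\<phi> ?d = 0\<^sub>v N" using carrier[of "pol y"] by (intro eq_vecI) auto
    ultimately have "?d = 0" using inj by blast
    then have "pol x = pol y" by simp
    then show "x = y" using x y coeff_pol[of x] coeff_pol[of y] by (intro eq_vecI) (auto, metis)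
  qed
  have "vectorspace.dim class_ring ?V = vectorspace.dim class_ring (?W\<lparr>carrier := ?C\<rparr>)"
    using surj by (intro T.dim_eq inj_T) (simp_all add: module_vec_simps vec_space.fin_dim)
  then have "code_dim N ?C = m" by (simp add: code_dim_def vec_space.dim_is_n)
  then show ?thesis using sub by (simp add: linear_code_def)
qed

section \<open>Encoding by generalized Roth-Lempel words\<close>

text \<open>Names the encoding map itself, so that linearity and inner products can be stated per
  polynomial, without a degree bound.\<close>

definition grl_word :: "nat \<Rightarrow> 'a::field vec \<Rightarrow> 'a vec \<Rightarrow> 'a mat \<Rightarrow> 'a poly \<Rightarrow> 'a vec" where
  "grl_word k a v A f = vec (dim_vec a) (\<lambda>i. v $ i * poly f (a $ i)) @\<^sub>v
     transpose_mat A *\<^sub>v vec (dim_row A) (\<lambda>j. coeff f (k - dim_row A + j))"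

lemma grl_code_eq_image: "grl_code k a v A = grl_word k a v A ` {f. degree f < k}"
  by (auto simp: grl_code_def grl_word_def)

lemma grl_word_carrier:
  assumes "a \<in> carrier_vec n" and "A \<in> carrier_mat s s"
  shows "grl_word k a v A f \<in> carrier_vec (n + s)"
  using assms by (intro carrier_vecI) (simp add: grl_word_def)

lemma grl_word_add: "grl_word k a v A (f + g) = grl_word k a v A f + grl_word k a v A g"
proof -
  let ?t = "\<lambda>f. vec (dim_row A) (\<lambda>j. coeff f (k - dim_row A + j))"
  have "?t (f + g) = ?t f + ?t g" by (intro eq_vecI) auto
  then have "transpose_mat A *\<^sub>v ?t (f + g) = transpose_mat A *\<^sub>v ?t f + transpose_mat A *\<^sub>v ?t g"
    by (simp add: mult_add_distrib_mat_vec[of _ "dim_col A" "dim_row A"])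
  then show ?thesis
    by (intro eq_vecI) (auto simp: grl_word_def algebra_simps)
qed

lemma grl_word_smult: "grl_word k a v A (Polynomial.smult c f) = c \<cdot>\<^sub>v grl_word k a v A f"
proof -
  let ?t = "\<lambda>f. vec (dim_row A) (\<lambda>j. coeff f (k - dim_row A + j))"
  have "?t (Polynomial.smult c f) = c \<cdot>\<^sub>v ?t f" by (intro eq_vecI) auto
  then have "transpose_mat A *\<^sub>v ?t (Polynomial.smult c f) = c \<cdot>\<^sub>v (transpose_mat A *\<^sub>v ?t f)"
    by (simp add: mult_mat_vec[of _ "dim_col A" "dim_row A"])
  then show ?thesis
    by (intro eq_vecI) (auto simp: grl_word_def algebra_simps)
qed

text \<open>The first \<open>n\<close> coordinates decide: as \<open>v\<close> has no zero entry,
  \<open>f\<close> has \<open>n\<close> distinct roots, while its degree is below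
  \<open>k \<le> n\<close>.\<close>

lemma grl_word_eq_zero:
  assumes params: "grl_params n s k a v A" and "degree f < k"
    and zero: "grl_word k a v A f = 0\<^sub>v (n + s)"
  shows "f = 0"
proof -
  have n: "dim_vec a = n" "k \<le> n" "inj_on (\<lambda>i. a $ i) {..<n}" "\<And>i. i < n \<Longrightarrow> v $ i \<noteq> 0"
    using params by (auto simp: grl_params_def)
  have "poly f (a $ i) = 0" if "i < n" for i
  proof -
    have "grl_word k a v A f $ i = v $ i * poly f (a $ i)"
      using that n(1) by (simp add: grl_word_def)
    then show ?thesis using zero that n(4) by simp
  qed
  then show ?thesis
    using assms(2) n card_image[OF n(3)]
    by (intro poly_eqI_degree[of "(\<lambda>i. a $ i) ` {..<n}"]) auto
qed

text \<open>Serves twice: \<open>P = 1\<close> and \<open>h = k\<close> give the whole code, a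
  product of linear factors gives the hull.\<close>

lemma linear_code_grl_multiples:
  assumes params: "grl_params n s k a v A" and "P \<noteq> 0" and "degree P + h \<le> k"
  shows "linear_code (n + s) h ((\<lambda>t. grl_word k a v A (P * t)) ` {t. t = 0 \<or> degree t < h})"
proof (rule linear_code_image)
  show "grl_word k a v A (P * (f + g)) = grl_word k a v A (P * f) + grl_word k a v A (P * g)" for f g
    by (simp add: distrib_left grl_word_add)
  show "grl_word k a v A (P * Polynomial.smult c f) = c \<cdot>\<^sub>v grl_word k a v A (P * f)" for c f
    by (simp add: grl_word_smult)
  show "grl_word k a v A (P * f) \<in> carrier_vec (n + s)" for f
    using params by (intro grl_word_carrier) (auto simp: grl_params_def GL_def)
  show "f = 0" if "degree f < h" "grl_word k a v A (P * f) = 0\<^sub>v (n + s)" for f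
  proof -
    have "degree (P * f) < k" using degree_mult_le[of P f] that(1) assms(3) by linarith
    then have "P * f = 0" using grl_word_eq_zero[OF params] that(2) by blast
    then show ?thesis using \<open>P \<noteq> 0\<close> by simp
  qed
qed

lemma linear_code_grl_code:
  assumes "grl_params n s k a v A"
  shows "linear_code (n + s) k (grl_code k a v A)"
proof -
  have "k > 0" using assms by (simp add: grl_params_def)
  then have "{t :: 'a poly. t = 0 \<or> degree t < k} = {t. degree t < k}" by auto
  then show ?thesis
    using linear_code_grl_multiples[OF assms, of 1 k] by (simp add: grl_code_eq_image)
qed

section \<open>Galois inner product of two code words\<close>

lemma galois_inner_append:
  fixes x :: "'a::field vec"
  assumes "dim_vec x = dim_vec x'" and "dim_vec y = dim_vec y'"
  shows "galois_inner p l (x @\<^sub>v y) (x' @\<^sub>v y') = galois_inner p l x x' + galois_inner p l y y'"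
proof -
  have split: "(\<Sum>i<m + n. f i) = (\<Sum>i<m. f i) + (\<Sum>i<n. f (m + i))" for f :: "nat \<Rightarrow> 'a" and m n
    by (induction n) (simp_all add: add.assoc)
  show ?thesis
    using assms by (simp add: galois_inner_def split)
qed

text \<open>Frobenius is additive, so it passes through the matrix product on the right argument.
  Moving the transpose of \<open>A\<close> across the pairing then creates the transpose of the
  product in \<open>AA\<close>, which is the same scalar matrix.\<close>

lemma galois_inner_mult_extension:
  fixes A :: "'a::{finite,field} mat"
  assumes "CHAR('a) = p" and "prime p"
    and A: "A \<in> carrier_mat s s"
    and AA: "map_mat (\<lambda>x. x ^ (p ^ l)) A * transpose_mat A = c \<cdot>\<^sub>m 1\<^sub>m s"
    and x: "x \<in> carrier_vec s" and y: "y \<in> carrier_vec s"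
  shows "galois_inner p l (transpose_mat A *\<^sub>v x) (transpose_mat A *\<^sub>v y) = c * galois_inner p l x y"
proof -
  let ?F = "\<lambda>x::'a. x ^ (p ^ l)"
  have inner: "galois_inner p l u w = u \<bullet> map_vec ?F w" if "u \<in> carrier_vec s" "w \<in> carrier_vec s" for u w
    using that by (simp add: galois_inner_def scalar_prod_def lessThan_atLeast0)
  have frob: "map_vec ?F (transpose_mat A *\<^sub>v y) = transpose_mat (map_mat ?F A) *\<^sub>v map_vec ?F y"
    using A y assms(1,2)
    by (intro eq_vecI)
      (auto simp: scalar_prod_def freshmans_dream_sum'[where n = l] power_mult_distrib)
  have "A * transpose_mat (map_mat ?F A) = transpose_mat (map_mat ?F A * transpose_mat A)"
    using A by (subst transpose_mult[of _ s s _ s]) auto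
  also have "\<dots> = c \<cdot>\<^sub>m 1\<^sub>m s" unfolding AA by (intro eq_matI) auto
  finally have AA': "A * transpose_mat (map_mat ?F A) = c \<cdot>\<^sub>m 1\<^sub>m s" .
  have "galois_inner p l (transpose_mat A *\<^sub>v x) (transpose_mat A *\<^sub>v y) =
      (transpose_mat A *\<^sub>v x) \<bullet> (transpose_mat (map_mat ?F A) *\<^sub>v map_vec ?F y)"
    using A x y by (subst inner) (auto simp: frob)
  also have "\<dots> = x \<bullet> (A *\<^sub>v (transpose_mat (map_mat ?F A) *\<^sub>v map_vec ?F y))"
    using A x y by (intro transpose_vec_mult_scalar[of _ s s]) auto
  also have "A *\<^sub>v (transpose_mat (map_mat ?F A) *\<^sub>v map_vec ?F y) = (c \<cdot>\<^sub>m 1\<^sub>m s) *\<^sub>v map_vec ?F y"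
    using A x y by (subst assoc_mult_mat_vec[of _ s s _ s, symmetric]) (auto simp: AA')
  also have "\<dots> = c \<cdot>\<^sub>v map_vec ?F y"
    using y by (intro eq_vecI) auto
  also have "x \<bullet> (c \<cdot>\<^sub>v map_vec ?F y) = c * galois_inner p l x y"
    using x y by (simp add: inner)
  finally show ?thesis .
qed

lemma galois_inner_grl_word:
  fixes a :: "'a::{finite,field} vec"
  assumes "CHAR('a) = p" and "prime p" and "a \<in> carrier_vec n" and A: "A \<in> carrier_mat s s"
    and AA: "map_mat (\<lambda>x. x ^ (p ^ l)) A * transpose_mat A = c \<cdot>\<^sub>m 1\<^sub>m s"
  shows "galois_inner p l (grl_word k a v A f) (grl_word k a v A g) =
    (\<Sum>i<n. (v $ i) ^ (p ^ l + 1) * (poly f (a $ i) * poly g (a $ i) ^ (p ^ l))) +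
    c * (\<Sum>j<s. coeff f (k - s + j) * coeff g (k - s + j) ^ (p ^ l))"
proof -
  let ?t = "\<lambda>f. vec s (\<lambda>j. coeff f (k - s + j))"
  have "galois_inner p l (grl_word k a v A f) (grl_word k a v A g) =
      galois_inner p l (vec n (\<lambda>i. v $ i * poly f (a $ i))) (vec n (\<lambda>i. v $ i * poly g (a $ i))) +
      galois_inner p l (transpose_mat A *\<^sub>v ?t f) (transpose_mat A *\<^sub>v ?t g)"
    using assms(3) A by (simp add: grl_word_def galois_inner_append)
  also have "galois_inner p l (transpose_mat A *\<^sub>v ?t f) (transpose_mat A *\<^sub>v ?t g) =
      c * galois_inner p l (?t f) (?t g)"
    using galois_inner_mult_extension[OF assms(1,2) A AA] by simp
  finally show ?thesis by (simp add: galois_inner_def power_mult_distrib mult_ac)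
qed

section \<open>The hull as the radical of a diagonal form\<close>

text \<open>By distinctness the product so far is nonzero at the new point, so the cofactor must
  vanish there.\<close>

lemma prod_linear_dvd:
  fixes g :: "'a::field poly"
  assumes "finite I" and "inj_on c I" and "\<And>i. i \<in> I \<Longrightarrow> poly g (c i) = 0"
  shows "(\<Prod>i\<in>I. [:- c i, 1:]) dvd g"
  using assms
proof (induction I)
  case (insert i I)
  then obtain t where t: "g = (\<Prod>i\<in>I. [:- c i, 1:]) * t" by (auto elim: dvdE)
  have "poly (\<Prod>i\<in>I. [:- c i, 1:]) (c i) \<noteq> 0"
    using insert.hyps insert.prems(1) by (auto simp: poly_prod)
  moreover have "poly g (c i) = 0" using insert.prems(2) by simp
  ultimately have "[:- c i, 1:] dvd t" using t by (simp add: poly_eq_0_iff_dvd)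
  then show ?case 
    unfolding t prod.insert[OF insert.hyps] mult.commute[of "[:- c i, 1:]"]
    by (rule mult_dvd_mono[OF dvd_refl])
qed simp

lemma degree_prod_linear:
  fixes c :: "'i \<Rightarrow> 'a::field"
  shows "degree (\<Prod>i\<in>I. [:- c i, 1:]) = card I"
  by (simp add: degree_prod_eq_sum_degree)

text \<open>Here \<open>w\<close> are the unperturbed weights, \<beta> the factor put on the first
  \<open>m\<close> of them, and \<mu> what interpolation leaves of the evaluation sum. The form is
  diagonal in \<open>m\<close> evaluations and the top \<open>s\<close> coefficients, with nonzero
  entries \<open>(\<beta> - 1) * w i\<close>, \<open>- \<eta>\<close> and, at index
  \<open>k - 1\<close>, \<open>\<mu> - \<eta>\<close>. As \<open>m \<le> k - s\<close>, test
  polynomials isolate each entry.\<close>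

lemma galois_hull_grl_code:
  fixes a :: "'a::{finite,field} vec"
  assumes char: "CHAR('a) = p" "prime p"
    and params: "grl_params n s k a v A"
    and AA: "map_mat (\<lambda>x. x ^ (p ^ l)) A * transpose_mat A = (- \<eta>) \<cdot>\<^sub>m 1\<^sub>m s"
    and "\<eta> \<noteq> 0" and "\<mu> \<noteq> \<eta>" and "\<beta> \<noteq> 1"
    and m: "m \<le> k - s"
    and w: "\<And>i. i < n \<Longrightarrow> w i \<noteq> 0"
    and v: "\<And>i. i < n \<Longrightarrow> (v $ i) ^ (p ^ l + 1) = (if i < m then \<beta> else 1) * w i"
    and gram: "\<And>f g. degree f < k \<Longrightarrow> degree g < k \<Longrightarrow>
      (\<Sum>i<n. w i * (poly f (a $ i) * poly g (a $ i) ^ (p ^ l))) =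
      \<mu> * (coeff f (k - 1) * coeff g (k - 1) ^ (p ^ l))"
  shows "galois_hull p l (n + s) (grl_code k a v A) =
    (\<lambda>t. grl_word k a v A ((\<Prod>i<m. [:- (a $ i), 1:]) * t)) ` {t. t = 0 \<or> degree t < k - s - m}"
proof -
  let ?W = "grl_word k a v A" and ?Q = "p ^ l"
  let ?P = "\<Prod>i<m. [:- (a $ i), 1:]"
  let ?vanish = "\<lambda>g. (\<forall>i<m. poly g (a $ i) = 0) \<and> (\<forall>j<s. coeff g (k - s + j) = 0)"
  have a: "a \<in> carrier_vec n" and A: "A \<in> carrier_mat s s" and s: "s \<ge> 1" "s \<le> k" and "k \<le> n"
    and inj: "inj_on (\<lambda>i. a $ i) {..<n}"
    using params by (auto simp: grl_params_def GL_def)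
  have mn: "m \<le> n" using m \<open>k \<le> n\<close> by simp
  have inj_m: "inj_on (\<lambda>i. a $ i) {..<m}" using inj mn by (auto intro: inj_on_subset)
  have Q: "?Q > 0" using char(2) prime_gt_0_nat by simp
  have form: "galois_inner p l (?W f) (?W g) =
      (\<Sum>i<m. (\<beta> - 1) * (w i * (poly f (a $ i) * poly g (a $ i) ^ ?Q))) +
      \<mu> * (coeff f (k - 1) * coeff g (k - 1) ^ ?Q) -
      \<eta> * (\<Sum>j<s. coeff f (k - s + j) * coeff g (k - s + j) ^ ?Q)"
    if "degree f < k" "degree g < k" for f g
  proof -
    let ?F = "\<lambda>i. w i * (poly f (a $ i) * poly g (a $ i) ^ ?Q)"
    \<comment> \<open>Splitting \<beta> as \<open>(\<beta> - 1) + 1\<close> separates the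
      perturbation from the sum covered by \<open>gram\<close>.\<close>
    have "(\<Sum>i<n. (v $ i) ^ (?Q + 1) * (poly f (a $ i) * poly g (a $ i) ^ ?Q)) =
        (\<Sum>i<n. (if i < m then (\<beta> - 1) * ?F i else 0) + ?F i)"
      using v by (intro sum.cong) (auto simp: algebra_simps)
    also have "\<dots> = (\<Sum>i<n. if i < m then (\<beta> - 1) * ?F i else 0) + (\<Sum>i<n. ?F i)"
      by (rule sum.distrib)
    also have "(\<Sum>i<n. if i < m then (\<beta> - 1) * ?F i else 0) = (\<Sum>i<m. (\<beta> - 1) * ?F i)"
      using mn by (intro sum.mono_neutral_cong_right) auto
    finally show ?thesis
      using gram[OF that] galois_inner_grl_word[OF char a A AA, of k v f g] by simp
  qed
  have vanish_iff: "(\<forall>f. degree f < k \<longrightarrow> galois_inner p l (?W f) (?W g) = 0) \<longleftrightarrow> ?vanish g"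
    if g: "degree g < k" for g
  proof
    assume "?vanish g"
    \<comment> \<open>The coefficient paired with \<mu> is the last of the top \<open>s\<close>, at
      \<open>j = s - 1\<close>.\<close>
    moreover have "k - s + (s - 1) = k - 1" "s - 1 < s" using s by simp_all
    ultimately have "coeff g (k - 1) = 0" by metis
    with \<open>?vanish g\<close>
    show "\<forall>f. degree f < k \<longrightarrow> galois_inner p l (?W f) (?W g) = 0"
      using form[OF _ g] Q by simp
  next
    assume orth: "\<forall>f. degree f < k \<longrightarrow> galois_inner p l (?W f) (?W g) = 0"
    have roots: "poly g (a $ i) = 0" if i: "i < m" for i
    proof -
      \<comment> \<open>This polynomial of degree \<open>m - 1 < k - s\<close> has no top
        coefficients and vanishes at every perturbed point except the \<open>i\<close>-th, so one
        term of the form remains.\<close>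
      let ?f = "\<Prod>r\<in>{..<m} - {i}. [:- (a $ r), 1:]"
      have deg: "degree ?f < k - s" using i m by (simp add: degree_prod_linear)
      have top: "coeff ?f (k - s + j) = 0" for j using deg by (intro coeff_eq_0) simp
      have top': "coeff ?f (k - 1) = 0" using deg s by (intro coeff_eq_0) simp
      have zero: "poly ?f (a $ r) = 0" if "r < m" "r \<noteq> i" for r
        using that by (auto simp: poly_prod)
      have "(\<Sum>r<m. (\<beta> - 1) * (w r * (poly ?f (a $ r) * poly g (a $ r) ^ ?Q))) =
          (\<Sum>r\<in>{i}. (\<beta> - 1) * (w r * (poly ?f (a $ r) * poly g (a $ r) ^ ?Q)))"
        using i zero by (intro sum.mono_neutral_right) auto
      then have "(\<beta> - 1) * (w i * (poly ?f (a $ i) * poly g (a $ i) ^ ?Q)) = 0"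
        using orth form[of ?f g] g deg top top' by simp
      moreover have "poly ?f (a $ i) \<noteq> 0"
        using i inj_m by (auto simp: poly_prod inj_on_def)
      moreover have "w i \<noteq> 0" using w i mn by simp
      ultimately show ?thesis using \<open>\<beta> \<noteq> 1\<close> by simp
    qed
    have "coeff g (k - s + j) = 0" if j: "j < s" for j
    proof -
      \<comment> \<open>A monomial meets one top coefficient. Its evaluations need not vanish, but
        \<open>roots\<close> already removes those terms through \<open>g\<close>.\<close>
      let ?f = "Polynomial.monom (1::'a) (k - s + j)"
      have deg: "degree ?f < k" using j s by (simp add: degree_monom_eq)
      have "(\<Sum>j'<s. coeff ?f (k - s + j') * coeff g (k - s + j') ^ ?Q) =
          (\<Sum>j'\<in>{j}. coeff ?f (k - s + j') * coeff g (k - s + j') ^ ?Q)"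
        using j by (intro sum.mono_neutral_right) auto
      then have "\<mu> * (coeff ?f (k - 1) * coeff g (k - 1) ^ ?Q) = \<eta> * coeff g (k - s + j) ^ ?Q"
        using orth form[OF deg g] deg roots Q by simp
      then have "(if k - s + j = k - 1 then \<mu> - \<eta> else - \<eta>) * coeff g (k - s + j) ^ ?Q = 0"
        by (auto simp: left_diff_distrib)
      then show ?thesis using \<open>\<mu> \<noteq> \<eta>\<close> \<open>\<eta> \<noteq> 0\<close> by (auto split: if_splits)
    qed
    then show "?vanish g" using roots by blast
  qed
  have P_deg: "degree ?P = m" by (simp add: degree_prod_linear)
  have P_nz: "?P \<noteq> 0" by simp
  \<comment> \<open>Vanishing of the top \<open>s\<close> coefficients lowers the degree below
    \<open>k - s\<close>; dividing out \<open>?P\<close>, of degree \<open>m\<close>, leaves a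
    cofactor of degree below \<open>k - s - m\<close>, or 0.\<close>
  have mult_iff: "degree g < k \<and> ?vanish g \<longleftrightarrow> (\<exists>t. g = ?P * t \<and> (t = 0 \<or> degree t < k - s - m))" for g
  proof
    assume g: "degree g < k \<and> ?vanish g"
    then have "?P dvd g" using inj_m by (intro prod_linear_dvd) auto
    then obtain t where t: "g = ?P * t" by (rule dvdE)
    have "degree g < k - s" if "g \<noteq> 0"
    proof (rule ccontr)
      assume "\<not> degree g < k - s"
      then have "coeff g (k - s + (degree g - (k - s))) = lead_coeff g" by simp
      moreover have "degree g - (k - s) < s" using g s by linarith
      ultimately show False using g that by auto
    qed
    have "degree t < k - s - m" if "t \<noteq> 0"
    proof -
      have "degree g = m + degree t" unfolding t degree_mult_eq[OF P_nz that] P_deg ..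
      moreover have "g \<noteq> 0" unfolding t using P_nz that by (rule no_zero_divisors)
      ultimately show ?thesis using \<open>g \<noteq> 0 \<Longrightarrow> degree g < k - s\<close> by simp
    qed
    then show "\<exists>t. g = ?P * t \<and> (t = 0 \<or> degree t < k - s - m)" using t by blast
  next
    assume "\<exists>t. g = ?P * t \<and> (t = 0 \<or> degree t < k - s - m)"
    then obtain t where t: "g = ?P * t" "t = 0 \<or> degree t < k - s - m" by blast
    have root: "poly g (a $ i) = 0" if "i < m" for i
      using that by (auto simp: t(1) poly_prod)
    have "g = 0 \<or> degree g < k - s"
      using t degree_mult_le[of ?P t] unfolding P_deg by auto
    then have "degree g < k \<and> (\<forall>j. coeff g (k - s + j) = 0)"
      using s by (auto intro: coeff_eq_0)
    then show "degree g < k \<and> ?vanish g" using root by blast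
  qed
  have "galois_hull p l (n + s) (grl_code k a v A) =
      ?W ` {g. degree g < k \<and> (\<forall>f. degree f < k \<longrightarrow> galois_inner p l (?W f) (?W g) = 0)}"
    using grl_word_carrier[OF a A]
    by (auto simp: galois_hull_def galois_dual_def grl_code_eq_image)
  also have "\<dots> = ?W ` {g. degree g < k \<and> ?vanish g}"
    using vanish_iff by (intro arg_cong[of _ _ "(`) ?W"] Collect_cong) blast
  also have "\<dots> = ?W ` ((*) ?P ` {t. t = 0 \<or> degree t < k - s - m})"
    unfolding mult_iff by (intro arg_cong[of _ _ "(`) ?W"]) blast
  finally show ?thesis by (simp add: image_image)
qed

section \<open>Collapse of the weighted evaluation sum\<close>

text \<open>Interpolation reads off the coefficient at \<open>n - 1\<close>. The polynomial summed
  has degree at most \<open>\<delta> - 1 + (k - 1) * (Q + 1)\<close>, so something can remain only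
  if this bound equals \<open>n - 1\<close>, and then it is the product of the top
  coefficients.\<close>

lemma gram_grl_weights:
  fixes a :: "'a::field vec"
  assumes "a \<in> carrier_vec n" and "inj_on (\<lambda>i. a $ i) {..<n}"
    and "\<delta> > 0" and "k > 0" and bound: "\<delta> - 1 + (k - 1) * (Q + 1) \<le> n - 1" and "n > 0"
    and "degree f < k" and "degree g < k"
  shows "(\<Sum>i<n. lam * (a $ i) ^ (\<delta> - 1) * u_coeff a i * (poly f (a $ i) * poly g (a $ i) ^ Q)) =
    (if \<delta> - 1 + (k - 1) * (Q + 1) = n - 1 then lam else 0) * (coeff f (k - 1) * coeff g (k - 1) ^ Q)"
proof -
  let ?d = "\<delta> - 1 + ((k - 1) + (k - 1) * Q)"
  let ?h = "Polynomial.monom 1 (\<delta> - 1) * (f * g ^ Q)"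
  have f: "degree f \<le> k - 1" and g: "degree g \<le> k - 1" using assms by auto
  have gQ: "degree (g ^ Q) \<le> (k - 1) * Q"
    using degree_power_le[of g Q] mult_le_mono1[OF g, of Q] by linarith
  have fg: "degree (f * g ^ Q) \<le> (k - 1) + (k - 1) * Q"
    using degree_mult_le[of f "g ^ Q"] f gQ by linarith
  have mon: "degree (Polynomial.monom (1::'a) (\<delta> - 1)) \<le> \<delta> - 1" by (rule degree_monom_le)
  have h: "degree ?h \<le> ?d" using degree_mult_le[of "Polynomial.monom 1 (\<delta> - 1)" "f * g ^ Q"] fg mon by linarith
  have d: "?d \<le> n - 1" using bound by simp
  have top: "coeff ?h ?d = coeff f (k - 1) * coeff g (k - 1) ^ Q"
    unfolding coeff_mult_at_degree_bounds[OF mon fg] coeff_mult_at_degree_bounds[OF f gQ]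
      coeff_power_at_degree_bound[OF g] by simp
  have "(\<Sum>i<n. lam * (a $ i) ^ (\<delta> - 1) * u_coeff a i * (poly f (a $ i) * poly g (a $ i) ^ Q)) =
      lam * (\<Sum>i<n. poly ?h (a $ i) * u_coeff a i)"
    by (simp add: sum_distrib_left poly_monom mult_ac)
  also have "(\<Sum>i<n. poly ?h (a $ i) * u_coeff a i) = coeff ?h (n - 1)"
    using sum_u_coeff[of a ?h] assms(1,2) h d \<open>n > 0\<close> by auto
  also have "\<dots> = (if ?d = n - 1 then coeff f (k - 1) * coeff g (k - 1) ^ Q else 0)"
    using top h d by (auto intro!: coeff_eq_0)
  finally show ?thesis by simp
qed

section \<open>Extension matrices and a divisibility\<close>

text \<open>Scalar matrices already solve the matrix equation once its right-hand scalar is a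
  \<open>(Q + 1)\<close>-th power; \<open>Q > 0\<close> keeps the off-diagonal zeros.\<close>

lemma scalar_extension_matrix:
  fixes c :: "'a::field"
  assumes "c \<noteq> 0" and "Q > 0"
  shows "c \<cdot>\<^sub>m 1\<^sub>m s \<in> GL s"
    and "map_mat (\<lambda>x. x ^ Q) (c \<cdot>\<^sub>m 1\<^sub>m s) * transpose_mat (c \<cdot>\<^sub>m 1\<^sub>m s) = c ^ (Q + 1) \<cdot>\<^sub>m 1\<^sub>m s"
proof -
  have mult: "(x \<cdot>\<^sub>m 1\<^sub>m s) * (y \<cdot>\<^sub>m 1\<^sub>m s) = (x * y) \<cdot>\<^sub>m 1\<^sub>m s" for x y :: 'a
    by (subst mult_smult_assoc_mat[of _ s s _ s]) auto
  have "invertible_mat (c \<cdot>\<^sub>m 1\<^sub>m s)"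
    unfolding invertible_mat_def inverts_mat_def
    using assms(1) by (intro conjI exI[of _ "inverse c \<cdot>\<^sub>m 1\<^sub>m s"]) (auto simp: mult)
  then show "c \<cdot>\<^sub>m 1\<^sub>m s \<in> GL s" by (simp add: GL_def)
  have "map_mat (\<lambda>x. x ^ Q) (c \<cdot>\<^sub>m 1\<^sub>m s) = c ^ Q \<cdot>\<^sub>m 1\<^sub>m s"
    using assms(2) by (intro eq_matI) (auto simp: power_mult_distrib)
  moreover have "transpose_mat (c \<cdot>\<^sub>m 1\<^sub>m s) = c \<cdot>\<^sub>m 1\<^sub>m s" by (intro eq_matI) auto
  ultimately show "map_mat (\<lambda>x. x ^ Q) (c \<cdot>\<^sub>m 1\<^sub>m s) * transpose_mat (c \<cdot>\<^sub>m 1\<^sub>m s) = c ^ (Q + 1) \<cdot>\<^sub>m 1\<^sub>m s"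
    by (simp add: mult mult.commute)
qed

text \<open>Powers of \<open>x\<close> are 1 modulo \<open>x - 1\<close>; at \<open>x = 0\<close>
  truncated subtraction makes both sides 0.\<close>

lemma pred_dvd_power_pred: "(x::nat) - 1 dvd x ^ r - 1"
proof (cases "x = 0")
  case False
  then have "[x ^ r = 1 ^ r] (mod (x - 1))" by (intro cong_pow) (simp add: cong_altdef_nat)
  then show ?thesis using False by (simp add: cong_altdef_nat)
qed (cases r; simp)

section \<open>Construction with prescribed hull dimension\<close>

text \<open>Only \<open>v\<close> is constructed and \<open>A\<close> stays arbitrary, so that both
  the existence claim and the boundary claim follow.\<close>

lemma exists_grl_code_with_hull_dim:
  fixes a :: "'a::{finite,field} vec"
  assumes char: "CHAR('a) = p" "prime p"
    and a: "a \<in> carrier_vec n" "inj_on (\<lambda>i. a $ i) {..<n}"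
    and s: "s \<ge> 1" "s < k" and "\<delta> > 0"
    and bound: "\<delta> + (k - 1) * (p ^ l + 1) \<le> n"
    and h: "h \<le> k - s"
    and w: "\<And>i. i < n \<Longrightarrow> lam * (a $ i) ^ (\<delta> - 1) * u_coeff a i \<in> unit_powers (p ^ l + 1)"
    and y: "y \<noteq> (0::'a)" "y ^ (p ^ l + 1) \<noteq> 1"
    and A: "A \<in> GL s"
    and AA: "map_mat (\<lambda>x. x ^ (p ^ l)) A * transpose_mat A = (- \<eta>) \<cdot>\<^sub>m 1\<^sub>m s"
    and "\<eta> \<noteq> 0" and \<eta>: "\<delta> + (k - 1) * (p ^ l + 1) = n \<Longrightarrow> \<eta> \<noteq> lam"
  shows "\<exists>v. grl_params n s k a v A \<and> linear_code (n + s) k (grl_code k a v A) \<and>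
    code_dim (n + s) (galois_hull p l (n + s) (grl_code k a v A)) = h"
proof -
  let ?Q = "p ^ l"
  let ?w = "\<lambda>i. lam * (a $ i) ^ (\<delta> - 1) * u_coeff a i"
  \<comment> \<open>Perturbing this many weights leaves exactly the cofactors of degree below
    \<open>h\<close>.\<close>
  let ?m = "k - s - h"
  have "\<forall>i. i < n \<longrightarrow> (\<exists>x. x \<noteq> 0 \<and> ?w i = x ^ (?Q + 1))"
    using w unfolding unit_powers_def by blast
  then obtain x where x: "\<And>i. i < n \<Longrightarrow> x i \<noteq> 0 \<and> ?w i = x i ^ (?Q + 1)" by metis
  \<comment> \<open>The \<open>(Q + 1)\<close>-th powers of these entries are the weights
    \<open>?w i\<close>, the first \<open>?m\<close> multiplied by \<open>y ^ (?Q + 1)\<close>,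
    which plays the role of \<beta>.\<close>
  define v where "v = vec n (\<lambda>i. (if i < ?m then y else 1) * x i)"
  have "k - 1 \<le> (k - 1) * (?Q + 1)" by simp
  then have kn: "k \<le> n" "n > 0" using bound \<open>\<delta> > 0\<close> by linarith+
  have params: "grl_params n s k a v A"
    using a s kn A x y(1) by (auto simp: grl_params_def v_def)
  define \<mu> where "\<mu> = (if \<delta> - 1 + (k - 1) * (?Q + 1) = n - 1 then lam else 0)"
  have boundary: "\<delta> + (k - 1) * (?Q + 1) = n" if "\<delta> - 1 + (k - 1) * (?Q + 1) = n - 1"
    using that \<open>\<delta> > 0\<close> \<open>n > 0\<close> by linarith
  have "\<mu> \<noteq> \<eta>" using \<eta> boundary \<open>\<eta> \<noteq> 0\<close> by (auto simp only: \<mu>_def split: if_splits)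
  have "\<delta> - 1 + (k - 1) * (?Q + 1) \<le> n - 1" using bound \<open>\<delta> > 0\<close> by linarith
  then have gram: "(\<Sum>i<n. ?w i * (poly f (a $ i) * poly g (a $ i) ^ ?Q)) =
      \<mu> * (coeff f (k - 1) * coeff g (k - 1) ^ ?Q)" if "degree f < k" "degree g < k" for f g
    unfolding \<mu>_def using a s \<open>\<delta> > 0\<close> \<open>n > 0\<close> that by (intro gram_grl_weights) auto
  let ?P = "\<Prod>i<?m. [:- (a $ i), 1:]"
  have hull: "galois_hull p l (n + s) (grl_code k a v A) =
      (\<lambda>t. grl_word k a v A (?P * t)) ` {t. t = 0 \<or> degree t < k - s - ?m}"
  proof (rule galois_hull_grl_code[OF char params AA \<open>\<eta> \<noteq> 0\<close> \<open>\<mu> \<noteq> \<eta>\<close> y(2)])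
    show "(v $ i) ^ (?Q + 1) = (if i < ?m then y ^ (?Q + 1) else 1) * ?w i" if "i < n" for i
      using x[OF that] that by (simp only: v_def index_vec power_mult_distrib) simp
    show "?w i \<noteq> 0" if "i < n" for i
      using x[OF that] by (metis power_not_zero)
  qed (use gram in auto)
  have "linear_code (n + s) h ((\<lambda>t. grl_word k a v A (?P * t)) ` {t. t = 0 \<or> degree t < h})"
    using h by (intro linear_code_grl_multiples[OF params]) (auto simp: degree_prod_linear)
  moreover have "k - s - ?m = h" using h by simp
  ultimately have "code_dim (n + s) (galois_hull p l (n + s) (grl_code k a v A)) = h"
    unfolding hull by (simp only: linear_code_def)
  then show ?thesis using params linear_code_grl_code[OF params] by blast
qed

section \<open>Numerical bounds and the choice of \<open>y\<close>, \<eta> and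
  \<open>A\<close>\<close>

theorem mainTheorem3:
  fixes p e l n s k h \<delta> :: nat
    and a :: "'a::{finite,field} vec"
    and lam :: 'a
    and K :: "'a set"
  assumes "prime p" and "CARD('a) = p ^ e" and "p ^ e > 4"
    and "l > 0" and "2 * l dvd e"
    and "subfield K class_ring" and "card K = p ^ l"
    and "a \<in> carrier_vec n" and "inj_on (\<lambda>i. a $ i) {..<n}"
    and "\<delta> > 0" and "lam \<noteq> 0" and "s \<ge> 1"
    and "\<forall>i<n. lam * (a $ i) ^ (\<delta> - 1) * u_coeff a i \<in> K - {0}"
    and "s < k"
    and "int k \<le> \<lfloor>(real n + real (p ^ l) - real \<delta> + 1) / (real (p ^ l) + 1)\<rfloor>"
    and "h \<le> k - s"
  shows
    "(\<exists>v A. grl_params n s k a v A \<and>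
        linear_code (n + s) k (grl_code k a v A) \<and>
        code_dim (n + s) (galois_hull p l (n + s) (grl_code k a v A)) = h)
     \<and>
     (int \<delta> - 1 + int (p ^ l) * (int k - 1) = int n - int k \<longrightarrow>
        (\<exists>\<eta>\<in>unit_powers (p ^ l + 1). \<eta> \<noteq> lam) \<and>
        (\<forall>\<eta>\<in>unit_powers (p ^ l + 1). \<eta> \<noteq> lam \<longrightarrow>
           (\<exists>A\<in>GL s. map_mat (\<lambda>x. x ^ (p ^ l)) A * transpose_mat A = (- \<eta>) \<cdot>\<^sub>m 1\<^sub>m s) \<and>
           (\<forall>A\<in>GL s. map_mat (\<lambda>x. x ^ (p ^ l)) A * transpose_mat A = (- \<eta>) \<cdot>\<^sub>m 1\<^sub>m s \<longrightarrow>
              (\<exists>v. grl_params n s k a v A \<and>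
                 linear_code (n + s) k (grl_code k a v A) \<and>
                 code_dim (n + s) (galois_hull p l (n + s) (grl_code k a v A)) = h))))"
proof -
  define Q where "Q = p ^ l"
  have char: "CHAR('a) = p" by (rule CHAR_eq_prime[OF assms(1,2)])
  have "p \<ge> 2" by (rule prime_ge_2_nat[OF assms(1)])
  then have Q: "Q \<ge> 2" unfolding Q_def using assms(4) self_le_power[of p l] by linarith
  obtain r where r: "e = 2 * l * r" using assms(5) by (rule dvdE)
  \<comment> \<open>Here \<open>2 * l dvd e\<close> enters: the field order is a power of
    \<open>Q ^ 2\<close>, hence \<open>Q ^ 2 - 1\<close> divides the order of the unit
    group.\<close>
  have card: "CARD('a) = (Q ^ 2) ^ r"
    unfolding assms(2) r Q_def by (simp only: power_mult[symmetric] mult_ac)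
  have "r > 0" using assms(3) r by (cases r) auto
  then have "Q ^ 2 \<le> CARD('a)" unfolding card using Q by (intro self_le_power) auto
  \<comment> \<open>Ensures that some nonzero \<open>y\<close> has
    \<open>y ^ (Q + 1) \<noteq> 1\<close>. The tight case is \<open>Q = 2\<close>, where
    \<open>Q ^ 2 = Q + 2\<close> and the assumption \<open>p ^ e > 4\<close> is decisive.\<close>
  have "Q + 2 < CARD('a)"
  proof (cases "Q = 2")
    case True
    then show ?thesis using assms(2,3) by simp
  next
    case False
    then have "3 * Q \<le> Q ^ 2" using Q by (simp add: power2_eq_square)
    then show ?thesis using False Q \<open>Q ^ 2 \<le> CARD('a)\<close> by linarith
  qed
  then obtain y :: 'a where y: "y \<noteq> 0" "y ^ (Q + 1) \<noteq> 1"
    using exists_unit_power_neq_one[of "Q + 1", where ?'a = 'a] by auto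
  have K: "K - {0} \<subseteq> unit_powers (Q + 1)"
    using Q assms(6,7) pred_dvd_power_pred[of "Q ^ 2" r] unfolding card[symmetric]
    by (intro subfield_subset_unit_powers) (simp_all add: Q_def)
  have "real k \<le> (real n + real Q - real \<delta> + 1) / (real Q + 1)"
    using assms(15) unfolding Q_def[symmetric] le_floor_iff by simp
  then have "real k * (real Q + 1) \<le> real n + real Q - real \<delta> + 1"
    by (simp add: pos_le_divide_eq)
  then have "real (k * (Q + 1) + \<delta>) \<le> real (n + Q + 1)" by (simp add: algebra_simps)
  then have "k * (Q + 1) + \<delta> \<le> n + Q + 1" by (simp only: of_nat_le_iff)
  \<comment> \<open>Splitting off one \<open>Q + 1\<close> cancels the \<open>Q + 1\<close> on the
    right of the cleared floor bound.\<close>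
  moreover have k: "k * (Q + 1) = (k - 1) * (Q + 1) + (Q + 1)" using assms(14) by (cases k) auto
  ultimately have bound: "\<delta> + (k - 1) * (Q + 1) \<le> n" by linarith
  have unit_nz: "\<eta> \<noteq> 0" if "\<eta> \<in> unit_powers (Q + 1)" for \<eta> :: 'a
    using that by (auto simp: unit_powers_def)
  have code: "\<exists>v. grl_params n s k a v A \<and> linear_code (n + s) k (grl_code k a v A) \<and>
      code_dim (n + s) (galois_hull p l (n + s) (grl_code k a v A)) = h"
    if "\<eta> \<in> unit_powers (Q + 1)" "\<eta> \<noteq> lam" "A \<in> GL s"
      "map_mat (\<lambda>x. x ^ Q) A * transpose_mat A = (- \<eta>) \<cdot>\<^sub>m 1\<^sub>m s" for A \<eta>
    unfolding Q_def
  proof (rule exists_grl_code_with_hull_dim[OF char assms(1,8,9,12,14,10)])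
    show "\<eta> \<noteq> lam" by (rule that(2))
    show "\<delta> + (k - 1) * (p ^ l + 1) \<le> n" using bound by (simp only: Q_def)
    show "lam * (a $ i) ^ (\<delta> - 1) * u_coeff a i \<in> unit_powers (p ^ l + 1)" if "i < n" for i
      using assms(13) K that unfolding Q_def by blast
    show "map_mat (\<lambda>x. x ^ (p ^ l)) A * transpose_mat A = (- \<eta>) \<cdot>\<^sub>m 1\<^sub>m s"
      using that(4) by (simp only: Q_def)
  qed (fact assms(16) y[unfolded Q_def] unit_nz[OF that(1)] that(3))+
  have ext: "\<exists>A\<in>GL s. map_mat (\<lambda>x. x ^ Q) A * transpose_mat A = (- \<eta>) \<cdot>\<^sub>m 1\<^sub>m s"
    if "\<eta> \<in> unit_powers (Q + 1)" for \<eta> :: 'a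
  proof -
    obtain z where z: "z \<noteq> 0" "\<eta> = z ^ (Q + 1)" using \<open>\<eta> \<in> _\<close> by (auto simp: unit_powers_def)
    \<comment> \<open>With \<open>- 1\<close> and \<eta> both \<open>(Q + 1)\<close>-th powers, so
      is \<open>- \<eta>\<close>, and a scalar matrix works.\<close>
    have "(- 1 :: 'a) \<in> unit_powers (Q + 1)" by (rule subsetD[OF K minus_one_in_subfield[OF assms(6)]])
    then obtain i :: 'a where i: "i \<noteq> 0" "- 1 = i ^ (Q + 1)" by (auto simp: unit_powers_def)
    have "(i * z) ^ (Q + 1) = - \<eta>" unfolding power_mult_distrib z(2) i(2)[symmetric] by simp
    moreover have "i * z \<noteq> 0" "Q > 0" using i(1) z(1) Q by simp_all
    ultimately show ?thesis using scalar_extension_matrix[of "i * z" Q s] by metis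
  qed
  \<comment> \<open>Both 1 and \<open>y ^ (Q + 1)\<close> are \<open>(Q + 1)\<close>-th powers and
    they differ, so one of them is not \<open>lam\<close>.\<close>
  have ex_\<eta>: "\<exists>\<eta>\<in>unit_powers (Q + 1). \<eta> \<noteq> lam"
  proof -
    have "x ^ (Q + 1) \<in> unit_powers (Q + 1)" if "x \<noteq> 0" for x :: 'a
      unfolding unit_powers_def using that by (intro imageI) simp
    from this[of 1] this[OF y(1)] have "(1::'a) \<in> unit_powers (Q + 1)" "y ^ (Q + 1) \<in> unit_powers (Q + 1)"
      by simp_all
    then show ?thesis using y(2) by metis
  qed
  show ?thesis
    unfolding Q_def[symmetric] using code ext ex_\<eta> by blast
qed

end
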